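(* Let $(L,\mu,R,d)$ be a Reynolds LieDer pair. Then $(L,\mu,R,d)$ is rigid if $\mathcal{H}^2_{\mathrm{RLieDer}}(L,L)=0$.
   Context: All vector spaces are over a ground field $K$. A Reynolds LieDer pair $(L,\mu,R,d)$ is a Lie algebra $L$ with bracket $\mu=[-,-]$, a linear map $R:L\to L$ (Reynolds operator) with $[Rx,Ry]=R([Rx,y]+[x,Ry]-[Rx,Ry])$, and a derivation $d$ of $L$ with $R\circ d=d\circ R$. A one-parameter formal deformation of $(L,\mu,R,d)$ is a triple of power series $\mu_t=\sum_{i\ge0}\mu_it^i$, $R_t=\sum_{i\ge0}R_it^i$, $d_t=\sum_{i\ge0}d_it^i$, with $\mu_i\in\mathrm{Hom}(\wedge^2L,L)$, $R_i,d_i\in\mathrm{Hom}(L,L)$, $(\mu_0,R_0,d_0)=(\mu,R,d)$, such that $(L[[t]],\mu_t,R_t,d_t)$, with maps extended $K[[t]]$-(bi)linearly, is a Reynolds LieDer pair over $K[[t]]$. A formal isomorphism between $(\mu_t,R_t,d_t)$ and $(\mu'_t,R'_t,d'_t)$ is a power series $\psi_t=\sum_{i\ge0}\psi_it^i:L[[t]]\to L[[t]]$ with $\psi_i:L\to L$ linear and $\psi_0=\mathrm{Id}_L$, such that $\psi_t\circ\mu'_t=\mu_t\circ(\psi_t\otimes\psi_t)$, $\psi_t\circ R'_t=R_t\circ\psi_t$, $\psi_t\circ d'_t=d_t\circ\psi_t$. Two deformations are equivalent if a formal isomorphism between them exists; a deformation is trivial if it is equivalent to the constant deformation $(\mu,R,d)$.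 $(L,\mu,R,d)$ is rigid if every one-parameter formal deformation of it is trivial. Complex with coefficients in the adjoint representation. For $f\in\mathrm{Hom}(\wedge^nL,L)$, $n\ge1$: $$(\delta_{CE}f)(x_1,\dots,x_{n+1})=\sum_{i=1}^{n+1}(-1)^{i+n}[x_i,f(x_1,\dots,\hat x_i,\dots,x_{n+1})]+\sum_{1\le i<j\le n+1}(-1)^{i+j+n+1}f([x_i,x_j],x_1,\dots,\hat x_i,\dots,\hat x_j,\dots,x_{n+1});$$ $\delta_R$ is given by the same formula with the argument bracket $[x_i,x_j]$ replaced by $[x_i,x_j]_R$, where $[x,y]_R=[x,Ry]+[Rx,y]-[Rx,Ry]$, and the action $[x_i,-]$ replaced by $\rho_R(x_i)$, where $\rho_R(x)u=[Rx,u]+R([Rx,u]-[x,u])$; $$(\varphi f)(x_1,\dots,x_n)=f(Rx_1,\dots,Rx_n)-R\sum_{i=1}^nf(Rx_1,\dots,Rx_{i-1},x_i,Rx_{i+1},\dots,Rx_n)+(n-1)Rf(Rx_1,\dots,Rx_n);$$ $$(\Delta f)(x_1,\dots,x_n)=\sum_{i=1}^nf(x_1,\dots,dx_i,\dots,x_n)-d(f(x_1,\dots,x_n)).$$ Put $C^1_R(L,L)=\mathrm{Hom}(L,L)$ and $C^n_R(L,L)=\mathrm{Hom}(\wedge^nL,L)\oplus\mathrm{Hom}(\wedge^{n-1}L,L)$ for $n\ge2$; $D_R(f)=(\delta_{CE}f,-\varphi f)$ for $n=1$, $D_R(f,g)=(\delta_{CE}f,-\delta_Rg-\varphi f)$ for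 $n\ge2$; $\Delta(f,g)=(\Delta f,\Delta g)$. Then $\mathfrak{C}^1_{\mathrm{RLieDer}}=C^1_R$, $\mathfrak{C}^n_{\mathrm{RLieDer}}=C^n_R\times C^{n-1}_R$ for $n\ge2$, $\mathfrak{D}_{\mathrm{RLieDer}}(f)=(D_Rf,-\Delta f)$ on degree $1$, and $\mathfrak{D}_{\mathrm{RLieDer}}(F,\tilde F)=(D_RF,\,D_R\tilde F+(-1)^n\Delta F)$ on degree $n\ge2$. $\mathcal{H}^2_{\mathrm{RLieDer}}(L,L)$ is the space of $2$-cocycles modulo $2$-coboundaries. *)

theory Defs
  imports
    "HOL-Computational_Algebra.Formal_Power_Series"
    "HOL-Library.Function_Algebras"
    "HOL-Library.Product_Plus"
begin

section \<open>Reynolds LieDer pairs\<close>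

definition alternating_bilinear ::
  "('a::comm_ring_1 \<Rightarrow> 'v::ab_group_add \<Rightarrow> 'v) \<Rightarrow> ('v \<Rightarrow> 'v \<Rightarrow> 'v) \<Rightarrow> bool" where
  "alternating_bilinear s b \<longleftrightarrow>
     (\<forall>x. module_hom s s (\<lambda>y. b x y)) \<and> (\<forall>y. module_hom s s (\<lambda>x. b x y)) \<and> (\<forall>x. b x x = 0)"

text \<open>The scalars form a commutative ring here, so that the same notion is available over a
  ground field \<open>K\<close> and over \<open>K[[t]]\<close>.\<close>

locale lie_algebra = module s
  for s :: "'a::comm_ring_1 \<Rightarrow> 'v::ab_group_add \<Rightarrow> 'v" +
  fixes br :: "'v \<Rightarrow> 'v \<Rightarrow> 'v"
  assumes bracket_alternating_bilinear: "alternating_bilinear s br"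
    and jacobi: "br x (br y z) + br y (br z x) + br z (br x y) = 0"

locale reynolds_lieder_pair = lie_algebra s br
  for s :: "'a::comm_ring_1 \<Rightarrow> 'v::ab_group_add \<Rightarrow> 'v" and br :: "'v \<Rightarrow> 'v \<Rightarrow> 'v" +
  fixes R d :: "'v \<Rightarrow> 'v"
  assumes R_linear: "module_hom s s R"
    and reynolds: "br (R x) (R y) = R (br (R x) y + br x (R y) - br (R x) (R y))"
    and d_linear: "module_hom s s d"
    and derivation: "d (br x y) = br (d x) y + br x (d y)"
    and R_d_commute: "R \<circ> d = d \<circ> R"


section \<open>Formal deformations\<close>

text \<open>\<open>L[[t]]\<close> is the type \<open>'v fps\<close>, with the action of \<open>K[[t]]\<close>, i.e. \<open>'k fps\<close>, by Cauchy
  products. A power series of (bi)linear maps of \<open>L\<close> is the sequence of its coefficients.\<close>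

definition fps_scale ::
  "('k::comm_ring_1 \<Rightarrow> 'v::ab_group_add \<Rightarrow> 'v) \<Rightarrow> 'k fps \<Rightarrow> 'v fps \<Rightarrow> 'v fps" where
  "fps_scale s a x = Abs_fps (\<lambda>n. \<Sum>i=0..n. s (fps_nth a i) (fps_nth x (n - i)))"

definition ext1 :: "(nat \<Rightarrow> 'v \<Rightarrow> 'v) \<Rightarrow> 'v::ab_group_add fps \<Rightarrow> 'v fps" where
  "ext1 f x = Abs_fps (\<lambda>n. \<Sum>i=0..n. f i (fps_nth x (n - i)))"

definition ext2 ::
  "(nat \<Rightarrow> 'v \<Rightarrow> 'v \<Rightarrow> 'v) \<Rightarrow> 'v::ab_group_add fps \<Rightarrow> 'v fps \<Rightarrow> 'v fps" where
  "ext2 b x y =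
     Abs_fps (\<lambda>n. \<Sum>i=0..n. \<Sum>j=0..n-i. b i (fps_nth x j) (fps_nth y (n - i - j)))"

definition constant_series :: "'b::zero \<Rightarrow> nat \<Rightarrow> 'b" where
  "constant_series f = (\<lambda>i. if i = 0 then f else 0)"

definition formal_deformation ::
  "('k::field \<Rightarrow> 'v::ab_group_add \<Rightarrow> 'v) \<Rightarrow> ('v \<Rightarrow> 'v \<Rightarrow> 'v) \<Rightarrow> ('v \<Rightarrow> 'v) \<Rightarrow> ('v \<Rightarrow> 'v) \<Rightarrow>
   (nat \<Rightarrow> 'v \<Rightarrow> 'v \<Rightarrow> 'v) \<Rightarrow> (nat \<Rightarrow> 'v \<Rightarrow> 'v) \<Rightarrow> (nat \<Rightarrow> 'v \<Rightarrow> 'v) \<Rightarrow> bool" where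
  "formal_deformation s mu R d mut Rt dt \<longleftrightarrow>
     (\<forall>i. alternating_bilinear s (mut i)) \<and>
     (\<forall>i. module_hom s s (Rt i)) \<and>
     (\<forall>i. module_hom s s (dt i)) \<and>
     mut 0 = mu \<and> Rt 0 = R \<and> dt 0 = d \<and>
     reynolds_lieder_pair (fps_scale s) (ext2 mut) (ext1 Rt) (ext1 dt)"

definition formal_isomorphism ::
  "('k::field \<Rightarrow> 'v::ab_group_add \<Rightarrow> 'v) \<Rightarrow> (nat \<Rightarrow> 'v \<Rightarrow> 'v) \<Rightarrow>
   (nat \<Rightarrow> 'v \<Rightarrow> 'v \<Rightarrow> 'v) \<Rightarrow> (nat \<Rightarrow> 'v \<Rightarrow> 'v) \<Rightarrow> (nat \<Rightarrow> 'v \<Rightarrow> 'v) \<Rightarrow>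
   (nat \<Rightarrow> 'v \<Rightarrow> 'v \<Rightarrow> 'v) \<Rightarrow> (nat \<Rightarrow> 'v \<Rightarrow> 'v) \<Rightarrow> (nat \<Rightarrow> 'v \<Rightarrow> 'v) \<Rightarrow> bool" where
  "formal_isomorphism s psi mut Rt dt mut' Rt' dt' \<longleftrightarrow>
     (\<forall>i. module_hom s s (psi i)) \<and> psi 0 = id \<and>
     (\<forall>x y. ext1 psi (ext2 mut' x y) = ext2 mut (ext1 psi x) (ext1 psi y)) \<and>
     ext1 psi \<circ> ext1 Rt' = ext1 Rt \<circ> ext1 psi \<and>
     ext1 psi \<circ> ext1 dt' = ext1 dt \<circ> ext1 psi"

definition equivalent_deformations ::
  "('k::field \<Rightarrow> 'v::ab_group_add \<Rightarrow> 'v) \<Rightarrow>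
   (nat \<Rightarrow> 'v \<Rightarrow> 'v \<Rightarrow> 'v) \<Rightarrow> (nat \<Rightarrow> 'v \<Rightarrow> 'v) \<Rightarrow> (nat \<Rightarrow> 'v \<Rightarrow> 'v) \<Rightarrow>
   (nat \<Rightarrow> 'v \<Rightarrow> 'v \<Rightarrow> 'v) \<Rightarrow> (nat \<Rightarrow> 'v \<Rightarrow> 'v) \<Rightarrow> (nat \<Rightarrow> 'v \<Rightarrow> 'v) \<Rightarrow> bool" where
  "equivalent_deformations s mut Rt dt mut' Rt' dt' \<longleftrightarrow>
     (\<exists>psi. formal_isomorphism s psi mut Rt dt mut' Rt' dt')"

definition trivial_deformation ::
  "('k::field \<Rightarrow> 'v::ab_group_add \<Rightarrow> 'v) \<Rightarrow> ('v \<Rightarrow> 'v \<Rightarrow> 'v) \<Rightarrow> ('v \<Rightarrow> 'v) \<Rightarrow> ('v \<Rightarrow> 'v) \<Rightarrow>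
   (nat \<Rightarrow> 'v \<Rightarrow> 'v \<Rightarrow> 'v) \<Rightarrow> (nat \<Rightarrow> 'v \<Rightarrow> 'v) \<Rightarrow> (nat \<Rightarrow> 'v \<Rightarrow> 'v) \<Rightarrow> bool" where
  "trivial_deformation s mu R d mut Rt dt \<longleftrightarrow>
     equivalent_deformations s mut Rt dt
       (constant_series mu) (constant_series R) (constant_series d)"

definition rigid ::
  "('k::field \<Rightarrow> 'v::ab_group_add \<Rightarrow> 'v) \<Rightarrow> ('v \<Rightarrow> 'v \<Rightarrow> 'v) \<Rightarrow> ('v \<Rightarrow> 'v) \<Rightarrow> ('v \<Rightarrow> 'v) \<Rightarrow> bool" where
  "rigid s mu R d \<longleftrightarrow>
     (\<forall>mut Rt dt. formal_deformation s mu R d mut Rt dt \<longrightarrow>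
        trivial_deformation s mu R d mut Rt dt)"


section \<open>The cochain complex with coefficients in the adjoint representation\<close>

text \<open>An element of \<open>Hom(\<Lambda>\<^sup>n L, L)\<close> is an alternating \<open>n\<close>-linear function, represented as a function
  on lists which is \<open>0\<close> on all lists of length other than \<open>n\<close>; this makes the representation
  unique, so that equality of cochains is equality of functions. List positions start at \<open>0\<close>.\<close>

definition Hom_alt ::
  "('k::field \<Rightarrow> 'v::ab_group_add \<Rightarrow> 'v) \<Rightarrow> nat \<Rightarrow> ('v list \<Rightarrow> 'v) set" where
  "Hom_alt s n = {f.
     (\<forall>xs i. length xs = n \<longrightarrow> i < n \<longrightarrow> module_hom s s (\<lambda>v. f (xs[i := v]))) \<and>
     (\<forall>xs i j. length xs = n \<longrightarrow> i < j \<longrightarrow> j < n \<longrightarrow> xs ! i = xs ! j \<longrightarrow> f xs = 0) \<and>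
     (\<forall>xs. length xs \<noteq> n \<longrightarrow> f xs = 0)}"

text \<open>The differential on \<open>n\<close>-cochains for an argument bracket \<open>br\<close> and an action \<open>rho\<close>. Counting
  positions from \<open>0\<close> turns the paper's sign \<open>(-1)\<^sup>i\<^sup>+\<^sup>n\<close> into \<open>(-1)\<^sup>i\<^sup>+\<^sup>1\<^sup>+\<^sup>n\<close> and leaves
  \<open>(-1)\<^sup>i\<^sup>+\<^sup>j\<^sup>+\<^sup>n\<^sup>+\<^sup>1\<close> unchanged. The list \<open>nths xs (- {i})\<close> is \<open>xs\<close> with position \<open>i\<close> omitted.\<close>

definition lie_differential ::
  "('k::field \<Rightarrow> 'v::ab_group_add \<Rightarrow> 'v) \<Rightarrow> ('v \<Rightarrow> 'v \<Rightarrow> 'v) \<Rightarrow> ('v \<Rightarrow> 'v \<Rightarrow> 'v) \<Rightarrow> nat \<Rightarrow>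
   ('v list \<Rightarrow> 'v) \<Rightarrow> 'v list \<Rightarrow> 'v" where
  "lie_differential s br rho n f xs =
     (if length xs = n + 1 then
        (\<Sum>i<n+1. s ((-1) ^ (i + 1 + n)) (rho (xs ! i) (f (nths xs (- {i}))))) +
        (\<Sum>j<n+1. \<Sum>i<j. s ((-1) ^ (i + j + n + 1))
            (f (br (xs ! i) (xs ! j) # nths xs (- {i, j}))))
      else 0)"

definition delta_CE where
  "delta_CE s mu n f = lie_differential s mu mu n f"

definition bracket_R ::
  "('v::ab_group_add \<Rightarrow> 'v \<Rightarrow> 'v) \<Rightarrow> ('v \<Rightarrow> 'v) \<Rightarrow> 'v \<Rightarrow> 'v \<Rightarrow> 'v" where
  "bracket_R mu R x y = mu x (R y) + mu (R x) y - mu (R x) (R y)"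

definition rho_R ::
  "('v::ab_group_add \<Rightarrow> 'v \<Rightarrow> 'v) \<Rightarrow> ('v \<Rightarrow> 'v) \<Rightarrow> 'v \<Rightarrow> 'v \<Rightarrow> 'v" where
  "rho_R mu R x u = mu (R x) u + R (mu (R x) u - mu x u)"

definition delta_R where
  "delta_R s mu R n f = lie_differential s (bracket_R mu R) (rho_R mu R) n f"

definition phi ::
  "('k::field \<Rightarrow> 'v::ab_group_add \<Rightarrow> 'v) \<Rightarrow> ('v \<Rightarrow> 'v) \<Rightarrow> nat \<Rightarrow>
   ('v list \<Rightarrow> 'v) \<Rightarrow> 'v list \<Rightarrow> 'v" where
  "phi s R n f xs =
     (if length xs = n then
        f (map R xs) - R (\<Sum>i<n. f ((map R xs)[i := xs ! i])) + s (of_nat (n - 1)) (R (f (map R xs)))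
      else 0)"

definition Delta ::
  "('v::ab_group_add \<Rightarrow> 'v) \<Rightarrow> nat \<Rightarrow> ('v list \<Rightarrow> 'v) \<Rightarrow> 'v list \<Rightarrow> 'v" where
  "Delta d n f xs =
     (if length xs = n then (\<Sum>i<n. f (xs[i := d (xs ! i)])) - d (f xs) else 0)"

text \<open>All degrees \<open>n \<ge> 1\<close> share one type: the components that are absent in degree \<open>1\<close> are \<open>0\<close>.
  Degree \<open>0\<close> is not part of the complex.\<close>

type_synonym 'v cochain_R = "('v list \<Rightarrow> 'v) \<times> ('v list \<Rightarrow> 'v)"
type_synonym 'v cochain_RLieDer = "'v cochain_R \<times> 'v cochain_R"

definition C_R :: "('k::field \<Rightarrow> 'v::ab_group_add \<Rightarrow> 'v) \<Rightarrow> nat \<Rightarrow> 'v cochain_R set" where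
  "C_R s n = (if n = 1 then Hom_alt s 1 \<times> {0} else Hom_alt s n \<times> Hom_alt s (n - 1))"

definition D_R ::
  "('k::field \<Rightarrow> 'v::ab_group_add \<Rightarrow> 'v) \<Rightarrow> ('v \<Rightarrow> 'v \<Rightarrow> 'v) \<Rightarrow> ('v \<Rightarrow> 'v) \<Rightarrow> nat \<Rightarrow>
   'v cochain_R \<Rightarrow> 'v cochain_R" where
  "D_R s mu R n = (\<lambda>(f, g).
     if n = 1 then (delta_CE s mu 1 f, - phi s R 1 f)
     else (delta_CE s mu n f, - delta_R s mu R (n - 1) g - phi s R n f))"

definition Delta_R ::
  "('v::ab_group_add \<Rightarrow> 'v) \<Rightarrow> nat \<Rightarrow> 'v cochain_R \<Rightarrow> 'v cochain_R" where
  "Delta_R d n = (\<lambda>(f, g). (Delta d n f, if n = 1 then 0 else Delta d (n - 1) g))"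

definition C_RLieDer ::
  "('k::field \<Rightarrow> 'v::ab_group_add \<Rightarrow> 'v) \<Rightarrow> nat \<Rightarrow> 'v cochain_RLieDer set" where
  "C_RLieDer s n = (if n = 1 then C_R s 1 \<times> {0} else C_R s n \<times> C_R s (n - 1))"

definition D_RLieDer ::
  "('k::field \<Rightarrow> 'v::ab_group_add \<Rightarrow> 'v) \<Rightarrow> ('v \<Rightarrow> 'v \<Rightarrow> 'v) \<Rightarrow> ('v \<Rightarrow> 'v) \<Rightarrow> ('v \<Rightarrow> 'v) \<Rightarrow> nat \<Rightarrow>
   'v cochain_RLieDer \<Rightarrow> 'v cochain_RLieDer" where
  "D_RLieDer s mu R d n = (\<lambda>(F, F').
     if n = 1 then (D_R s mu R 1 F, - Delta_R d 1 F)
     else (D_R s mu R n F,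
           D_R s mu R (n - 1) F' + (if even n then Delta_R d n F else - Delta_R d n F)))"

definition cocycles_RLieDer ::
  "('k::field \<Rightarrow> 'v::ab_group_add \<Rightarrow> 'v) \<Rightarrow> ('v \<Rightarrow> 'v \<Rightarrow> 'v) \<Rightarrow> ('v \<Rightarrow> 'v) \<Rightarrow> ('v \<Rightarrow> 'v) \<Rightarrow> nat \<Rightarrow>
   'v cochain_RLieDer set" where
  "cocycles_RLieDer s mu R d n = {c \<in> C_RLieDer s n. D_RLieDer s mu R d n c = 0}"

definition coboundaries_RLieDer ::
  "('k::field \<Rightarrow> 'v::ab_group_add \<Rightarrow> 'v) \<Rightarrow> ('v \<Rightarrow> 'v \<Rightarrow> 'v) \<Rightarrow> ('v \<Rightarrow> 'v) \<Rightarrow> ('v \<Rightarrow> 'v) \<Rightarrow> nat \<Rightarrow>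
   'v cochain_RLieDer set" where
  "coboundaries_RLieDer s mu R d n =
     (if n = 1 then {0} else D_RLieDer s mu R d (n - 1) ` C_RLieDer s (n - 1))"

text \<open>The quotient space, as the set of cosets of the coboundaries; its zero element is the set of
  coboundaries itself.\<close>

definition H_RLieDer ::
  "('k::field \<Rightarrow> 'v::ab_group_add \<Rightarrow> 'v) \<Rightarrow> ('v \<Rightarrow> 'v \<Rightarrow> 'v) \<Rightarrow> ('v \<Rightarrow> 'v) \<Rightarrow> ('v \<Rightarrow> 'v) \<Rightarrow> nat \<Rightarrow>
   'v cochain_RLieDer set set" where
  "H_RLieDer s mu R d n =
     (\<lambda>z. (\<lambda>b. z + b) ` coboundaries_RLieDer s mu R d n) ` cocycles_RLieDer s mu R d n"

end

theory Submission
  imports Defs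
begin

text \<open>Write \<open>\<psi>\<^sub>t a = \<Sum> \<psi>\<^sub>i a t\<^sup>i\<close>. A deformation is trivialised by constructing \<open>\<psi>\<^sub>t\<close> one coefficient at
  a time. Suppose that \<open>\<psi>\<^sub>t\<close> carries \<open>(\<mu>, R, d)\<close> to \<open>(\<mu>\<^sub>t, R\<^sub>t, d\<^sub>t)\<close> modulo \<open>t\<^sup>N\<close>, where
  \<open>N > 0\<close>. The failure at order \<open>N\<close> is measured by three maps \<open>E, F, G\<close>:
  modulo \<open>t\<^sup>N\<^sup>+\<^sup>1\<close>,
  \<open>\<mu>\<^sub>t (\<psi>\<^sub>t x, \<psi>\<^sub>t y) = \<psi>\<^sub>t [x, y] + E(x, y) t\<^sup>N\<close>, \<open>R\<^sub>t (\<psi>\<^sub>t x) = \<psi>\<^sub>t (R x) + F(x) t\<^sup>N\<close>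
  and \<open>d\<^sub>t (\<psi>\<^sub>t x) = \<psi>\<^sub>t (d x) + G(x) t\<^sup>N\<close>.
  Evaluating the Jacobi identity, the Reynolds identity, the derivation rule and the commutation
  of \<open>R\<^sub>t\<close> with \<open>d\<^sub>t\<close> on series of the form \<open>\<psi>\<^sub>t a + u t\<^sup>N\<close>, and reading off the coefficient
  at \<open>t\<^sup>N\<close>, shows that \<open>((E, F), (G, 0))\<close> is a 2-cocycle. These computations never invert
  \<open>\<psi>\<^sub>t\<close>; they are the subject of the lemmas on jets.

  As the second cohomology vanishes, the cocycle is the coboundary of a linear map \<open>f\<close>
  (\<open>infinitesimal_is_coboundary\<close>). Replacing \<open>\<psi>\<^sub>N\<close> by \<open>\<psi>\<^sub>N - f\<close> changes the three defects at order
  \<open>N\<close> by exactly the negative of that coboundary and leaves the lower orders alone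
  (\<open>extend_trivialisation\<close>). Since the coefficient \<open>\<psi>\<^sub>N\<close> is settled once order \<open>N\<close> is reached, the
  successive corrections define a single series \<open>\<psi>\<^sub>t\<close> (\<open>formal_trivialisation_exists\<close>).

  So far the intertwining relations are only known on constant series \<open>a \<in> L\<close>. They extend to
  \<open>L[[t]]\<close> because both sides are additive and commute with multiplication by \<open>t\<close>, and every
  series is \<open>a + t x\<close> for some \<open>a\<close> and \<open>x\<close> (\<open>eq_if_eq_on_constants\<close>).\<close>

section \<open>Coefficients of extended maps\<close>

definition fps_monomial :: "nat \<Rightarrow> 'v::zero \<Rightarrow> 'v fps" where
  "fps_monomial N u = Abs_fps (\<lambda>i. if i = N then u else 0)"

text \<open>The image of the constant series \<open>a\<close> under the extension of \<open>psi\<close> to power series, see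
  \<open>ext1_fps_monomial_0\<close> below.\<close>

definition orbit :: "(nat \<Rightarrow> 'v \<Rightarrow> 'v) \<Rightarrow> 'v \<Rightarrow> 'v fps" where
  "orbit psi a = Abs_fps (\<lambda>i. psi i a)"

lemma nth_fps_monomial [simp]: "fps_nth (fps_monomial N u) i = (if i = N then u else 0)"
  by (simp add: fps_monomial_def)

lemma nth_orbit [simp]: "fps_nth (orbit psi a) i = psi i a"
  by (simp add: orbit_def)

lemma module_homD:
  assumes "module_hom s s f"
  shows "f (x + y) = f x + f y" "f 0 = 0" "f (- x) = - f x" "f (x - y) = f x - f y"
    "f (s c x) = s c (f x)" "f (sum h A) = (\<Sum>i\<in>A. f (h i))"
proof -
  interpret module_hom s s f by fact
  show "f (x + y) = f x + f y" "f 0 = 0" "f (- x) = - f x" "f (x - y) = f x - f y"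
    "f (s c x) = s c (f x)" "f (sum h A) = (\<Sum>i\<in>A. f (h i))"
    by (simp_all add: add zero neg diff scale sum)
qed

lemma module_homI:
  assumes "module s" "\<And>x y. f (x + y) = f x + f y" "\<And>c x. f (s c x) = s c (f x)"
  shows "module_hom s s f"
  using assms by (simp add: module_hom_iff)

lemma alternating_bilinearD:
  assumes "alternating_bilinear s b"
  shows "module_hom s s (b x)" "module_hom s s (\<lambda>x. b x y)" "b x x = 0"
  using assms by (auto simp: alternating_bilinear_def)

lemma alternating_bilinear_skew:
  assumes "alternating_bilinear s b"
  shows "b y x = - b x y"
proof -
  note b = alternating_bilinearD[OF assms]
  have "0 = b (x + y) (x + y)" by (simp add: b(3))
  also have "\<dots> = b x y + b y x"
    by (simp add: module_homD(1)[OF b(1)] module_homD(1)[OF b(2)] b(3)[of x] b(3)[of y])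
  finally show ?thesis by (metis add.commute eq_neg_iff_add_eq_0)
qed

lemma nth_ext1: "fps_nth (ext1 f x) n = (\<Sum>i=0..n. f i (fps_nth x (n - i)))"
  by (simp add: ext1_def)

lemma nth_ext2:
  "fps_nth (ext2 b x y) n = (\<Sum>i=0..n. \<Sum>j=0..n-i. b i (fps_nth x j) (fps_nth y (n - i - j)))"
  by (simp add: ext2_def)

text \<open>The \<open>n\<close>-th coefficient of an extended map depends only on coefficients of the arguments up to
  degree \<open>n\<close>, so computations modulo \<open>t\<^sup>n\<^sup>+\<^sup>1\<close> are legitimate.\<close>

lemma ext1_cong_upto:
  assumes "\<And>i. i \<le> n \<Longrightarrow> fps_nth x i = fps_nth x' i"
  shows "fps_nth (ext1 f x) n = fps_nth (ext1 f x') n"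
  using assms by (simp add: nth_ext1)

lemma ext2_cong_upto:
  assumes "\<And>i. i \<le> n \<Longrightarrow> fps_nth x i = fps_nth x' i" "\<And>i. i \<le> n \<Longrightarrow> fps_nth y i = fps_nth y' i"
  shows "fps_nth (ext2 b x y) n = fps_nth (ext2 b x' y') n"
  using assms by (simp add: nth_ext2)

lemma ext1_add:
  assumes "\<And>i. module_hom s s (f i)"
  shows "ext1 f (x + y) = ext1 f x + ext1 f y"
  by (rule fps_ext) (simp add: nth_ext1 module_homD(1)[OF assms] sum.distrib)

lemma ext2_add_left:
  assumes "\<And>i. alternating_bilinear s (b i)"
  shows "ext2 b (x + x') y = ext2 b x y + ext2 b x' y"
  by (rule fps_ext)
    (simp add: nth_ext2 module_homD(1)[OF alternating_bilinearD(2)[OF assms]] sum.distrib)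

lemma ext2_add_right:
  assumes "\<And>i. alternating_bilinear s (b i)"
  shows "ext2 b x (y + y') = ext2 b x y + ext2 b x y'"
  by (rule fps_ext)
    (simp add: nth_ext2 module_homD(1)[OF alternating_bilinearD(1)[OF assms]] sum.distrib)

text \<open>On a perturbation of order \<open>N\<close> only the undeformed map acts, as long as orders beyond \<open>N\<close> are
  ignored: every higher coefficient of the deformed map raises the order further.\<close>

lemma ext1_monomial:
  assumes "\<And>i. module_hom s s (f i)" and "n \<le> N"
  shows "fps_nth (ext1 f (fps_monomial N u)) n = (if n = N then f 0 u else 0)"
proof -
  have "fps_nth (ext1 f (fps_monomial N u)) n = (\<Sum>i=0..n. if i = 0 then if n = N then f 0 u else 0 else 0)"
    unfolding nth_ext1 using assms(2) by (intro sum.cong) (auto simp: module_homD(2)[OF assms(1)])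
  then show ?thesis by simp
qed

lemma ext2_monomial_left:
  assumes "\<And>i. alternating_bilinear s (b i)" and "n \<le> N"
  shows "fps_nth (ext2 b (fps_monomial N u) y) n = (if n = N then b 0 u (fps_nth y 0) else 0)"
proof -
  note z = module_homD(2)[OF alternating_bilinearD(2)[OF assms(1)]]
  have "fps_nth (ext2 b (fps_monomial N u) y) n =
      (\<Sum>i=0..n. if i = 0 then if n = N then b 0 u (fps_nth y 0) else 0 else 0)"
    unfolding nth_ext2
  proof (intro sum.cong refl)
    fix i assume i: "i \<in> {0..n}"
    have "(\<Sum>j=0..n-i. b i (fps_nth (fps_monomial N u) j) (fps_nth y (n - i - j))) =
       (\<Sum>j=0..n-i. if j = N then b i u (fps_nth y (n - i - N)) else 0)"
      by (intro sum.cong) (auto simp: z)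
    then show "(\<Sum>j=0..n-i. b i (fps_nth (fps_monomial N u) j) (fps_nth y (n - i - j))) =
       (if i = 0 then if n = N then b 0 u (fps_nth y 0) else 0 else 0)"
      using i assms(2) by auto
  qed
  then show ?thesis by simp
qed

text \<open>Skew-symmetry is inherited coefficientwise, by reversing the inner Cauchy product. It turns each
  fact about the first argument of \<^term>\<open>ext2\<close> into one about the second.\<close>

lemma ext2_skew:
  assumes "\<And>i. alternating_bilinear s (b i)"
  shows "ext2 b y x = - ext2 b x y"
proof (rule fps_ext)
  fix n
  have "(\<Sum>j=0..n-i. b i (fps_nth y j) (fps_nth x (n - i - j))) =
     - (\<Sum>j=0..n-i. b i (fps_nth x j) (fps_nth y (n - i - j)))" for i
  proof -
    have "(\<Sum>j=0..n-i. b i (fps_nth y j) (fps_nth x (n - i - j))) =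
        (\<Sum>j=0..n-i. b i (fps_nth y (n - i - j)) (fps_nth x j))"
      by (subst sum.atLeastAtMost_rev) (intro sum.cong refl, simp del: diff_diff_left)
    also have "\<dots> = (\<Sum>j=0..n-i. - b i (fps_nth x j) (fps_nth y (n - i - j)))"
      by (intro sum.cong refl) (rule alternating_bilinear_skew[OF assms])
    finally show ?thesis by (simp add: sum_negf)
  qed
  then show "fps_nth (ext2 b y x) n = fps_nth (- ext2 b x y) n"
    by (simp add: nth_ext2 sum_negf)
qed

lemma ext2_monomial_right:
  assumes "\<And>i. alternating_bilinear s (b i)" and "n \<le> N"
  shows "fps_nth (ext2 b x (fps_monomial N u)) n = (if n = N then b 0 (fps_nth x 0) u else 0)"
  using ext2_monomial_left[OF assms, where u = u and y = x]
    alternating_bilinear_skew[OF assms(1)[of 0], of u "fps_nth x 0"]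
  by (simp add: ext2_skew[OF assms(1), where y = x and x = "fps_monomial N u"])

lemma ext1_fps_monomial_0:
  assumes "\<And>i. module_hom s s (f i)"
  shows "ext1 f (fps_monomial 0 a) = orbit f a"
proof (rule fps_ext)
  fix n
  have "fps_nth (ext1 f (fps_monomial 0 a)) n = (\<Sum>i=0..n. if i = n then f n a else 0)"
    unfolding nth_ext1 by (intro sum.cong) (auto simp: module_homD(2)[OF assms(1)])
  then show "fps_nth (ext1 f (fps_monomial 0 a)) n = fps_nth (orbit f a) n" by simp
qed

section \<open>Maps of power series that commute with multiplication by the parameter\<close>

definition fps_times_X :: "'v::zero fps \<Rightarrow> 'v fps" where
  "fps_times_X x = Abs_fps (\<lambda>i. case i of 0 \<Rightarrow> 0 | Suc j \<Rightarrow> fps_nth x j)"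

lemma nth_fps_times_X [simp]:
  "fps_nth (fps_times_X x) 0 = 0" "fps_nth (fps_times_X x) (Suc n) = fps_nth x n"
  by (simp_all add: fps_times_X_def)

lemma ext1_times_X:
  assumes "\<And>i. module_hom s s (f i)"
  shows "ext1 f (fps_times_X x) = fps_times_X (ext1 f x)"
proof (rule fps_ext)
  fix n show "fps_nth (ext1 f (fps_times_X x)) n = fps_nth (fps_times_X (ext1 f x)) n"
    by (cases n) (simp_all add: nth_ext1 module_homD(2)[OF assms] Suc_diff_le)
qed

lemma ext2_times_X_left:
  assumes "\<And>i. alternating_bilinear s (b i)"
  shows "ext2 b (fps_times_X x) y = fps_times_X (ext2 b x y)"
proof (rule fps_ext)
  note z = module_homD(2)[OF alternating_bilinearD(2)[OF assms(1)]]
  fix n show "fps_nth (ext2 b (fps_times_X x) y) n = fps_nth (fps_times_X (ext2 b x y)) n"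
  proof (cases n)
    case (Suc m)
    have "(\<Sum>j=0..Suc m-i. b i (fps_nth (fps_times_X x) j) (fps_nth y (Suc m - i - j))) =
      (\<Sum>j=0..m-i. b i (fps_nth x j) (fps_nth y (m - i - j)))" if "i \<le> m" for i
      by (simp only: Suc_diff_le[OF that] sum.atLeast0_atMost_Suc_shift) (simp add: z)
    then show ?thesis by (simp add: Suc nth_ext2 z)
  qed (simp add: nth_ext2 z)
qed

lemma fps_times_X_minus: "fps_times_X (- x) = - fps_times_X (x :: 'v::ab_group_add fps)"
proof (rule fps_ext)
  fix n show "fps_nth (fps_times_X (- x)) n = fps_nth (- fps_times_X x) n" by (cases n) simp_all
qed

lemma ext2_times_X_right:
  assumes "\<And>i. alternating_bilinear s (b i)"
  shows "ext2 b x (fps_times_X y) = fps_times_X (ext2 b x y)"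
  by (simp add: ext2_skew[OF assms, where y = x] ext2_times_X_left[OF assms] fps_times_X_minus)

lemma fps_monomial_0_plus_times_X:
  "x = fps_monomial 0 (fps_nth x 0) + fps_times_X (Abs_fps (\<lambda>i. fps_nth x (Suc i)))"
  for x :: "'v::ab_group_add fps"
proof (rule fps_ext)
  fix n show "fps_nth x n =
    fps_nth (fps_monomial 0 (fps_nth x 0) + fps_times_X (Abs_fps (\<lambda>i. fps_nth x (Suc i)))) n"
    by (cases n) simp_all
qed

text \<open>Constants do not generate \<open>L[[t]]\<close> as a \<open>K[[t]]\<close>-module when \<open>L\<close> has infinite dimension, so
  linearity alone would not be enough. Induction on the coefficient is: \<open>x = a + t y\<close>, and the
  coefficient at \<open>n + 1\<close> of the image of \<open>t y\<close> is the coefficient at \<open>n\<close> of the image of \<open>y\<close>.\<close>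

lemma eq_if_eq_on_constants:
  fixes G H :: "'v::ab_group_add fps \<Rightarrow> 'v fps"
  assumes "\<And>x y. G (x + y) = G x + G y" "\<And>x y. H (x + y) = H x + H y"
    and "\<And>x. G (fps_times_X x) = fps_times_X (G x)" "\<And>x. H (fps_times_X x) = fps_times_X (H x)"
    and "\<And>a. G (fps_monomial 0 a) = H (fps_monomial 0 a)"
  shows "G x = H x"
proof (rule fps_ext)
  fix n show "fps_nth (G x) n = fps_nth (H x) n"
  proof (induction n arbitrary: x)
    case 0
    show ?case by (subst (1 2) fps_monomial_0_plus_times_X) (simp add: assms)
  next
    case (Suc n)
    show ?case by (subst (1 2) fps_monomial_0_plus_times_X) (simp add: assms Suc)
  qed
qed

lemma ext1_intertwines_if_on_constants:
  fixes f :: "'v::ab_group_add \<Rightarrow> 'v"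
  assumes psi: "\<And>i. module_hom s s (psi i)" and f: "module_hom s s f"
    and ft: "\<And>i. module_hom s s (ft i)"
    and eq: "\<And>a. orbit psi (f a) = ext1 ft (orbit psi a)"
  shows "ext1 psi \<circ> ext1 (constant_series f) = ext1 ft \<circ> ext1 psi"
proof -
  have "module_hom s s (0 :: 'v \<Rightarrow> 'v)"
    using f by (simp add: module_hom_iff module.scale_zero_right)
  then have cf: "\<And>i. module_hom s s (constant_series f i)"
    using f by (simp add: constant_series_def)
  have "orbit (constant_series f) a = fps_monomial 0 (f a)" for a
    by (rule fps_ext) (simp add: constant_series_def)
  then show ?thesis
    by (intro ext, unfold comp_apply)
      (rule eq_if_eq_on_constants[where G = "\<lambda>x. ext1 psi (ext1 (constant_series f) x)"
            and H = "\<lambda>x. ext1 ft (ext1 psi x)"], simp_all add: ext1_add[OF psi] ext1_add[OF cf] ext1_add[OF ft]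
        ext1_times_X[OF psi] ext1_times_X[OF cf] ext1_times_X[OF ft]
        ext1_fps_monomial_0[OF psi] ext1_fps_monomial_0[OF cf] eq)
qed

text \<open>The reduction to constants is applied twice, first to the second argument with a constant first
  argument, then to the first argument.\<close>

lemma ext2_intertwines_if_on_constants:
  fixes b :: "'v::ab_group_add \<Rightarrow> 'v \<Rightarrow> 'v"
  assumes psi: "\<And>i. module_hom s s (psi i)" and b: "alternating_bilinear s b"
    and bt: "\<And>i. alternating_bilinear s (bt i)"
    and eq: "\<And>x y. orbit psi (b x y) = ext2 bt (orbit psi x) (orbit psi y)"
  shows "ext1 psi (ext2 (constant_series b) x y) = ext2 bt (ext1 psi x) (ext1 psi y)"
proof -
  have "alternating_bilinear s (0 :: 'v \<Rightarrow> 'v \<Rightarrow> 'v)"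
    using b by (simp add: alternating_bilinear_def module_hom_iff module.scale_zero_right)
  then have cb: "\<And>i. alternating_bilinear s (constant_series b i)"
    using b by (simp add: constant_series_def)
  note simps = ext1_add[OF psi] ext1_times_X[OF psi] ext1_fps_monomial_0[OF psi]
    ext2_add_left[OF cb] ext2_add_left[OF bt] ext2_add_right[OF cb] ext2_add_right[OF bt]
    ext2_times_X_left[OF cb] ext2_times_X_left[OF bt]
    ext2_times_X_right[OF cb] ext2_times_X_right[OF bt]
  have c: "ext2 (constant_series b) (fps_monomial 0 u) (fps_monomial 0 v) = fps_monomial 0 (b u v)" for u v
  proof (rule fps_ext)
    note z = module_homD(2)[OF alternating_bilinearD(1)[OF b]]
      module_homD(2)[OF alternating_bilinearD(2)[OF b]]
    fix n :: nat
    have "(\<Sum>j=0..n. b (if j = 0 then u else 0) (if n - j = 0 then v else 0)) =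
        (\<Sum>j=0..n. if j = 0 then if n = 0 then b u v else 0 else 0)"
      by (intro sum.cong) (auto simp: z)
    then have "fps_nth (ext2 (constant_series b) (fps_monomial 0 u) (fps_monomial 0 v)) n =
        (\<Sum>i=0..n. if i = 0 then if n = 0 then b u v else 0 else 0)"
      unfolding nth_ext2 by (intro sum.cong) (auto simp: constant_series_def)
    then show "fps_nth (ext2 (constant_series b) (fps_monomial 0 u) (fps_monomial 0 v)) n =
      fps_nth (fps_monomial 0 (b u v)) n" by simp
  qed
  have *: "ext1 psi (ext2 (constant_series b) (fps_monomial 0 u) y) = ext2 bt (orbit psi u) (ext1 psi y)"
    for u y
    by (rule eq_if_eq_on_constants[where G = "\<lambda>y. ext1 psi (ext2 (constant_series b) (fps_monomial 0 u) y)"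
          and H = "\<lambda>y. ext2 bt (orbit psi u) (ext1 psi y)"]) (simp_all add: simps c eq)
  show ?thesis
    by (rule eq_if_eq_on_constants[where G = "\<lambda>x. ext1 psi (ext2 (constant_series b) x y)"
          and H = "\<lambda>x. ext2 bt (ext1 psi x) (ext1 psi y)"]) (simp_all add: simps *)
qed

section \<open>Vanishing of the second cohomology\<close>

text \<open>The value \<open>0\<close> on lists of the wrong length is what \<^const>\<open>Hom_alt\<close> demands.\<close>

definition cochain1 :: "('v \<Rightarrow> 'v) \<Rightarrow> 'v::zero list \<Rightarrow> 'v" where
  "cochain1 f xs = (case xs of [x] \<Rightarrow> f x | _ \<Rightarrow> 0)"

definition cochain2 :: "('v \<Rightarrow> 'v \<Rightarrow> 'v) \<Rightarrow> 'v::zero list \<Rightarrow> 'v" where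
  "cochain2 b xs = (case xs of [x, y] \<Rightarrow> b x y | _ \<Rightarrow> 0)"

lemma cochain1_simps [simp]: "cochain1 f [x] = f x" "length xs \<noteq> 1 \<Longrightarrow> cochain1 f xs = 0"
  by (auto simp: cochain1_def split: list.splits)

lemma cochain2_simps [simp]: "cochain2 b [x, y] = b x y" "length xs \<noteq> 2 \<Longrightarrow> cochain2 b xs = 0"
  by (auto simp: cochain2_def split: list.splits)

lemma length_eq_1_E: assumes "length xs = 1" obtains x where "xs = [x]"
  using assms by (auto simp: length_Suc_conv)

lemma length_eq_2_E: assumes "length xs = 2" obtains x y where "xs = [x, y]"
  using assms by (auto simp: length_Suc_conv numeral_2_eq_2)

lemma length_eq_3_E: assumes "length xs = 3" obtains x y z where "xs = [x, y, z]"
  using assms by (auto simp: length_Suc_conv numeral_3_eq_3)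

lemma cochain1_in_Hom_alt:
  assumes "module_hom s s f"
  shows "cochain1 f \<in> Hom_alt s 1"
  using assms by (auto simp: Hom_alt_def length_Suc_conv)

lemma cochain2_in_Hom_alt:
  assumes "alternating_bilinear s b"
  shows "cochain2 b \<in> Hom_alt s 2"
  using alternating_bilinearD[OF assms]
  by (auto simp: Hom_alt_def numeral_2_eq_2 length_Suc_conv less_Suc_eq)

lemma Hom_alt_1_linear:
  assumes "g \<in> Hom_alt s 1"
  shows "module_hom s s (\<lambda>v. g [v])"
proof -
  have "module_hom s s (\<lambda>v. g ([0][0 := v]))"
    using assms unfolding Hom_alt_def by (auto dest!: spec[of _ "[0]"])
  then show ?thesis by simp
qed

lemma lie_differential_1:
  assumes "module s"
  shows "lie_differential s br rho 1 f [x, y] = rho x (f [y]) - rho y (f [x]) - f [br x y]"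
proof -
  interpret module s by fact
  show ?thesis
    by (simp add: lie_differential_def numeral_eq_Suc nths_Cons lessThan_Suc)
qed

lemma lie_differential_2:
  assumes "module s"
  shows "lie_differential s br rho 2 f [x, y, z] =
     rho y (f [x, z]) - rho x (f [y, z]) - rho z (f [x, y])
     + f [br x y, z] - f [br x z, y] + f [br y z, x]"
proof -
  interpret module s by fact
  show ?thesis
    by (simp add: lie_differential_def numeral_eq_Suc nths_Cons lessThan_Suc)
qed

text \<open>Vanishing cohomology says that every coset of a cocycle equals the set of coboundaries. To
  conclude that the cocycle itself is a coboundary, its coset must be known to contain it.\<close>

lemma zero_in_coboundaries_2:
  assumes "reynolds_lieder_pair s mu R d"
  shows "0 \<in> coboundaries_RLieDer s mu R d 2"
proof -
  interpret reynolds_lieder_pair s mu R d by fact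
  have "0 \<in> C_RLieDer s 1"
    by (simp add: C_RLieDer_def C_R_def Hom_alt_def zero_prod_def module_hom_iff module_axioms)
  moreover have "D_RLieDer s mu R d 1 0 = 0"
    using module_homD(2)[OF R_linear] module_homD(2)[OF d_linear]
      module_homD(2)[OF alternating_bilinearD(1)[OF bracket_alternating_bilinear]]
    by (simp add: D_RLieDer_def D_R_def Delta_R_def delta_CE_def lie_differential_def phi_def
        Delta_def zero_prod_def fun_eq_iff)
  ultimately show ?thesis
    unfolding coboundaries_RLieDer_def by force
qed

text \<open>The four hypotheses \<open>jac\<close>, \<open>rey\<close>, \<open>der\<close> and \<open>com\<close> are the linearised axioms of a Reynolds LieDer
  pair, in the form in which jets produce them. They match the four components of
  \<open>D_RLieDer s mu R d 2\<close> applied to \<open>((E, F), (G, 0))\<close>: \<open>\<delta>\<^sub>C\<^sub>E E\<close>, \<open>- \<delta>\<^sub>R F - \<phi> E\<close>,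
  \<open>\<delta>\<^sub>C\<^sub>E G + \<Delta> E\<close> and \<open>- \<phi> G + \<Delta> F\<close>. The three conclusions are the components of
  \<open>D_RLieDer s mu R d 1\<close> applied to \<open>f\<close>.\<close>

lemma infinitesimal_is_coboundary:
  fixes s :: "'k::field \<Rightarrow> 'v::ab_group_add \<Rightarrow> 'v"
  assumes pair: "reynolds_lieder_pair s mu R d"
    and H: "H_RLieDer s mu R d 2 = {coboundaries_RLieDer s mu R d 2}"
    and E: "alternating_bilinear s E" and F: "module_hom s s F" and G: "module_hom s s G"
    and jac: "\<And>x y z. E x (mu y z) + mu x (E y z) + (E y (mu z x) + mu y (E z x))
        + (E z (mu x y) + mu z (E x y)) = 0"
    and rey: "\<And>x y. E (R x) (R y) + mu (F x) (R y) + mu (R x) (F y) =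
        F (mu (R x) y + mu x (R y) - mu (R x) (R y))
        + R (E (R x) y + mu (F x) y + (E x (R y) + mu x (F y))
             - (E (R x) (R y) + mu (F x) (R y) + mu (R x) (F y)))"
    and der: "\<And>x y. G (mu x y) + d (E x y) = E (d x) y + mu (G x) y + (E x (d y) + mu x (G y))"
    and com: "\<And>x. F (d x) + R (G x) = G (R x) + d (F x)"
  obtains f where "module_hom s s f"
    and "\<And>x y. E x y = mu x (f y) + mu (f x) y - f (mu x y)"
    and "\<And>x. F x = R (f x) - f (R x)"
    and "\<And>x. G x = d (f x) - f (d x)"
proof -
  interpret reynolds_lieder_pair s mu R d by fact
  note mod = module_axioms
  note mu = bracket_alternating_bilinear
  note lin = module_homD(1-4)[OF R_linear] module_homD(1-4)[OF d_linear]
    module_homD(1-4)[OF alternating_bilinearD(1)[OF mu]]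
    module_homD(1-4)[OF alternating_bilinearD(2)[OF mu]]
    module_homD(1-4)[OF alternating_bilinearD(1)[OF E]]
    module_homD(1-4)[OF alternating_bilinearD(2)[OF E]]
    module_homD(1-4)[OF F] module_homD(1-4)[OF G]
  note skew = alternating_bilinear_skew[OF mu] alternating_bilinear_skew[OF E]
  define c where "c = ((cochain2 E, cochain1 F), (cochain1 G, 0 :: 'v list \<Rightarrow> 'v))"
  have "c \<in> C_RLieDer s 2"
    using cochain2_in_Hom_alt[OF E] cochain1_in_Hom_alt[OF F] cochain1_in_Hom_alt[OF G]
    by (simp add: c_def C_RLieDer_def C_R_def)
  moreover have "D_RLieDer s mu R d 2 c = 0"
  proof -
    have 1: "delta_CE s mu 2 (cochain2 E) xs = 0" for xs
    proof (cases "length xs = 3")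
      case True
      then obtain x y z where xs: "xs = [x, y, z]" by (rule length_eq_3_E)
      have "E (mu x z) y = E y (mu z x)"
        using skew(2)[of "mu x z" y] by (simp add: skew(1)[of x z] lin)
      then have "delta_CE s mu 2 (cochain2 E) xs = - (E x (mu y z) + mu x (E y z)
          + (E y (mu z x) + mu y (E z x)) + (E z (mu x y) + mu z (E x y)))"
        using skew(2)[of "mu x y" z] skew(2)[of "mu y z" x] skew(2)[of x z]
        by (simp add: delta_CE_def lie_differential_2[OF mod] xs lin algebra_simps)
      then show ?thesis by (simp only: jac minus_zero)
    qed (simp add: delta_CE_def lie_differential_def)
    have 2: "- delta_R s mu R 1 (cochain1 F) xs - phi s R 2 (cochain2 E) xs = 0" for xs
    proof (cases "length xs = 2")
      case True
      then obtain x y where xs: "xs = [x, y]" by (rule length_eq_2_E)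
      show ?thesis
        using rey[of x y] skew(1)[of "F x" y] skew(1)[of "F x" "R y"]
        by (simp add: delta_R_def lie_differential_1[OF mod, simplified] phi_def xs lin rho_R_def bracket_R_def
            numeral_eq_Suc lessThan_Suc algebra_simps)
    qed (simp add: delta_R_def phi_def lie_differential_def)
    have 3: "delta_CE s mu 1 (cochain1 G) xs + Delta d 2 (cochain2 E) xs = 0" for xs
    proof (cases "length xs = 2")
      case True
      then obtain x y where xs: "xs = [x, y]" by (rule length_eq_2_E)
      show ?thesis
        using der[of x y] skew(1)[of "G x" y]
        by (simp add: delta_CE_def lie_differential_1[OF mod, simplified] Delta_def xs lin
            numeral_eq_Suc lessThan_Suc algebra_simps)
    qed (simp add: delta_CE_def Delta_def lie_differential_def)
    have 4: "- phi s R 1 (cochain1 G) xs + Delta d 1 (cochain1 F) xs = 0" for xs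
    proof (cases "length xs = 1")
      case True
      then obtain x where xs: "xs = [x]" by (rule length_eq_1_E)
      show ?thesis
        using com[of x] by (simp add: phi_def Delta_def xs lin algebra_simps)
    qed (simp add: phi_def Delta_def)
    show ?thesis
      using 1 2 3 4
      by (simp add: c_def D_RLieDer_def D_R_def Delta_R_def zero_prod_def fun_eq_iff)
  qed
  ultimately have "c \<in> cocycles_RLieDer s mu R d 2"
    by (simp add: cocycles_RLieDer_def)
  then have "(\<lambda>b. c + b) ` coboundaries_RLieDer s mu R d 2 = coboundaries_RLieDer s mu R d 2"
    using H unfolding H_RLieDer_def by blast
  then have "c + 0 \<in> coboundaries_RLieDer s mu R d 2"
    using zero_in_coboundaries_2[OF pair] by blast
  then obtain a where a: "a \<in> C_RLieDer s 1" "c = D_RLieDer s mu R d 1 a"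
    by (auto simp: coboundaries_RLieDer_def)
  then obtain g where g: "g \<in> Hom_alt s 1" "a = ((g, 0), 0)"
    by (auto simp: C_RLieDer_def C_R_def)
  define f where "f = (\<lambda>v. g [v])"
  have eqs: "cochain2 E = delta_CE s mu 1 g" "cochain1 F = - phi s R 1 g"
     "cochain1 G = - Delta d 1 g"
    using a(2) by (simp_all add: g(2) c_def D_RLieDer_def D_R_def Delta_R_def)
  show thesis
  proof
    show "module_hom s s f" unfolding f_def by (rule Hom_alt_1_linear) (rule g(1))
    show "E x y = mu x (f y) + mu (f x) y - f (mu x y)" for x y
      using fun_cong[OF eqs(1), of "[x, y]"] skew(1)[of "f x" y]
      by (simp add: delta_CE_def lie_differential_1[OF mod, simplified] f_def)
    show "F x = R (f x) - f (R x)" for x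
      using fun_cong[OF eqs(2), of "[x]"] by (simp add: phi_def f_def)
    show "G x = d (f x) - f (d x)" for x
      using fun_cong[OF eqs(3), of "[x]"] by (simp add: Delta_def f_def)
  qed
qed

section \<open>Jets along a truncated trivialisation\<close>

text \<open>\<open>jet psi N X a u\<close> says \<open>X = \<psi>\<^sub>t a + u t\<^sup>N\<close> modulo \<open>t\<^sup>N\<^sup>+\<^sup>1\<close>. If the defects below order \<open>N\<close>
  vanish, the deformed operations act on such pairs \<open>(a, u)\<close> as the undeformed operations, with the
  defects at order \<open>N\<close> as an additional term in \<open>u\<close>.\<close>

definition jet ::
  "(nat \<Rightarrow> 'v \<Rightarrow> 'v) \<Rightarrow> nat \<Rightarrow> 'v::ab_group_add fps \<Rightarrow> 'v \<Rightarrow> 'v \<Rightarrow> bool" where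
  "jet psi N X a u \<longleftrightarrow> (\<forall>i\<le>N. fps_nth X i = psi i a + (if i = N then u else 0))"

definition bracket_defect ::
  "(nat \<Rightarrow> 'v \<Rightarrow> 'v \<Rightarrow> 'v) \<Rightarrow> ('v \<Rightarrow> 'v \<Rightarrow> 'v) \<Rightarrow> (nat \<Rightarrow> 'v \<Rightarrow> 'v) \<Rightarrow> nat \<Rightarrow>
   'v::ab_group_add \<Rightarrow> 'v \<Rightarrow> 'v" where
  "bracket_defect bt b psi N x y =
     fps_nth (ext2 bt (orbit psi x) (orbit psi y)) N - psi N (b x y)"

definition map_defect ::
  "(nat \<Rightarrow> 'v \<Rightarrow> 'v) \<Rightarrow> ('v \<Rightarrow> 'v) \<Rightarrow> (nat \<Rightarrow> 'v \<Rightarrow> 'v) \<Rightarrow> nat \<Rightarrow> 'v::ab_group_add \<Rightarrow> 'v" where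
  "map_defect ft f psi N x = fps_nth (ext1 ft (orbit psi x)) N - psi N (f x)"

lemma bracket_defect_cong:
  assumes "\<And>i. i \<le> N \<Longrightarrow> psi i = psi' i"
  shows "bracket_defect bt b psi N = bracket_defect bt b psi' N"
  using assms
  by (auto simp: bracket_defect_def fun_eq_iff
      intro!: arg_cong2[of _ _ _ _ minus] ext2_cong_upto)

lemma map_defect_cong:
  assumes "\<And>i. i \<le> N \<Longrightarrow> psi i = psi' i"
  shows "map_defect ft f psi N = map_defect ft f psi' N"
  using assms
  by (auto simp: map_defect_def fun_eq_iff intro!: arg_cong2[of _ _ _ _ minus] ext1_cong_upto)

lemma jet_orbit: "jet psi N (orbit psi a) a 0"
  by (simp add: jet_def)

lemma jet_update: "jet psi N (orbit (psi(N := \<lambda>x. psi N x + g x)) a) a (g a)"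
  by (simp add: jet_def)

text \<open>The pairs \<open>(a, u)\<close> obey the following calculus. An identity between deformed operations thus
  becomes an equality of two values of \<open>u\<close>, by \<open>jet_unique\<close>.\<close>

lemma jet_add:
  assumes "\<And>i. module_hom s s (psi i)" "jet psi N X a u" "jet psi N Y b v"
  shows "jet psi N (X + Y) (a + b) (u + v)"
  using assms(2,3) by (simp add: jet_def module_homD(1)[OF assms(1)])

lemma jet_diff:
  assumes "\<And>i. module_hom s s (psi i)" "jet psi N X a u" "jet psi N Y b v"
  shows "jet psi N (X - Y) (a - b) (u - v)"
  using assms(2,3) by (simp add: jet_def module_homD(4)[OF assms(1)])

lemma jet_unique: "jet psi N X a u \<Longrightarrow> jet psi N X a v \<Longrightarrow> u = v"
  by (auto simp: jet_def dest!: spec[of _ N])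

lemma jet_nth: "jet psi N X a u \<Longrightarrow> fps_nth X i = fps_nth (orbit psi a + fps_monomial N u) i" if "i \<le> N"
  using that by (simp add: jet_def)

lemma jet_ext1:
  assumes ft: "\<And>i. module_hom s s (ft i)" "ft 0 = f"
    and below: "\<And>i. i < N \<Longrightarrow> map_defect ft f psi i = 0"
    and X: "jet psi N X a u"
  shows "jet psi N (ext1 ft X) (f a) (map_defect ft f psi N a + f u)"
  unfolding jet_def
proof (intro allI impI)
  fix i assume i: "i \<le> N"
  have "fps_nth (ext1 ft X) i = fps_nth (ext1 ft (orbit psi a + fps_monomial N u)) i"
    using jet_nth[OF _ X] i by (intro ext1_cong_upto) auto
  also have "\<dots> = psi i (f a) + map_defect ft f psi i a + (if i = N then f u else 0)"
    using i ft(2) by (simp add: ext1_add[OF ft(1)] ext1_monomial[OF ft(1)] map_defect_def)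
  finally show "fps_nth (ext1 ft X) i =
      psi i (f a) + (if i = N then map_defect ft f psi N a + f u else 0)"
    using below[of i] i by auto
qed

text \<open>The product of the two perturbations has order \<open>2 N\<close> and does not contribute because \<open>N > 0\<close>;
  \<open>\<psi>\<^sub>0 = id\<close> makes the mixed terms \<open>[u, y]\<close> and \<open>[x, v]\<close> at order \<open>N\<close>.\<close>

lemma jet_ext2:
  assumes bt: "\<And>i. alternating_bilinear s (bt i)" "bt 0 = b"
    and psi0: "psi 0 = id" and N: "N > 0"
    and below: "\<And>i. i < N \<Longrightarrow> bracket_defect bt b psi i = 0"
    and X: "jet psi N X x u" and Y: "jet psi N Y y v"
  shows "jet psi N (ext2 bt X Y) (b x y) (bracket_defect bt b psi N x y + b u y + b x v)"
  unfolding jet_def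
proof (intro allI impI)
  have "alternating_bilinear s b" using bt(1)[of 0] by (simp add: bt(2))
  note z = module_homD(2)[OF alternating_bilinearD(2)[OF this]]
  fix i assume i: "i \<le> N"
  have "fps_nth (ext2 bt X Y) i =
      fps_nth (ext2 bt (orbit psi x + fps_monomial N u) (orbit psi y + fps_monomial N v)) i"
    using jet_nth[OF _ X] jet_nth[OF _ Y] i by (intro ext2_cong_upto) auto
  also have "\<dots> = psi i (b x y) + bracket_defect bt b psi i x y + (if i = N then b u y + b x v else 0)"
    using i N bt(2)
    by (simp add: ext2_add_left[OF bt(1)] ext2_add_right[OF bt(1)] ext2_monomial_left[OF bt(1)]
        ext2_monomial_right[OF bt(1)] bracket_defect_def psi0 z)
  finally show "fps_nth (ext2 bt X Y) i =
      psi i (b x y) + (if i = N then bracket_defect bt b psi N x y + b u y + b x v else 0)"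
    using below[of i] i by (auto simp: algebra_simps)
qed

lemma map_defect_linear:
  assumes "module_hom s s f" "\<And>i. module_hom s s (ft i)" "\<And>i. module_hom s s (psi i)"
  shows "module_hom s s (map_defect ft f psi N)"
proof -
  interpret module s using assms(1) by (simp add: module_hom_iff)
  show ?thesis
    by (rule module_homI[OF module_axioms])
      (simp_all add: map_defect_def nth_ext1 sum.distrib scale_sum_right scale_right_diff_distrib
        module_homD(1,5)[OF assms(1)] module_homD(1,5)[OF assms(2)] module_homD(1,5)[OF assms(3)])
qed

lemma bracket_defect_alternating_bilinear:
  assumes "alternating_bilinear s b" "\<And>i. alternating_bilinear s (bt i)"
    "\<And>i. module_hom s s (psi i)" "\<And>X. ext2 bt X X = 0"
  shows "alternating_bilinear s (bracket_defect bt b psi N)"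
proof -
  interpret module s using assms(3) by (simp add: module_hom_iff)
  note simps = nth_ext2 sum.distrib scale_sum_right scale_right_diff_distrib
    module_homD(1,5)[OF alternating_bilinearD(1)[OF assms(1)]]
    module_homD(1,5)[OF alternating_bilinearD(1)[OF assms(2)]]
    module_homD(1,5)[OF alternating_bilinearD(2)[OF assms(1)]]
    module_homD(1,5)[OF alternating_bilinearD(2)[OF assms(2)]]
    module_homD(1,5)[OF assms(3)]
  show ?thesis
    unfolding alternating_bilinear_def
  proof (intro conjI allI)
    show "module_hom s s (\<lambda>y. bracket_defect bt b psi N x y)" for x
      by (rule module_homI[OF module_axioms]) (simp_all add: bracket_defect_def simps)
    show "module_hom s s (\<lambda>x. bracket_defect bt b psi N x y)" for y
      by (rule module_homI[OF module_axioms]) (simp_all add: bracket_defect_def simps)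
    show "bracket_defect bt b psi N x x = 0" for x
      by (simp add: bracket_defect_def assms(4) alternating_bilinearD(3)[OF assms(1)]
          module_homD(2)[OF assms(3)])
  qed
qed

section \<open>Order by order trivialisation\<close>

definition trivialises_at where
  "trivialises_at mu R d mut Rt dt psi n \<longleftrightarrow> bracket_defect mut mu psi n = 0 \<and>
     map_defect Rt R psi n = 0 \<and> map_defect dt d psi n = 0"

lemma trivialises_at_cong:
  assumes "\<And>i. i \<le> n \<Longrightarrow> psi i = psi' i"
  shows "trivialises_at mu R d mut Rt dt psi n = trivialises_at mu R d mut Rt dt psi' n"
  unfolding trivialises_at_def
  using bracket_defect_cong[of n psi psi' mut mu, OF assms]
    map_defect_cong[of n psi psi' Rt R, OF assms] map_defect_cong[of n psi psi' dt d, OF assms]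
  by simp

text \<open>The inductive step. The defects at order \<open>N\<close> satisfy the linearised axioms and so are the
  coboundary of some \<open>f\<close>; the correction is \<open>g = - f\<close>. Relative to the old \<open>\<psi>\<^sub>t\<close> the corrected image of
  \<open>x\<close> is the jet \<open>(x, g x)\<close>, so the new defects come from the same jet calculus as the identities
  that established the cocycle condition.\<close>

lemma extend_trivialisation:
  fixes s :: "'k::field \<Rightarrow> 'v::ab_group_add \<Rightarrow> 'v"
  assumes pair: "reynolds_lieder_pair s mu R d"
    and H: "H_RLieDer s mu R d 2 = {coboundaries_RLieDer s mu R d 2}"
    and deform: "formal_deformation s mu R d mut Rt dt"
    and psi: "\<And>i. module_hom s s (psi i)" "psi 0 = id" and N: "N > 0"
    and below: "\<And>i. i < N \<Longrightarrow> trivialises_at mu R d mut Rt dt psi i"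
  obtains g where "module_hom s s g"
    and "trivialises_at mu R d mut Rt dt (psi(N := \<lambda>x. psi N x + g x)) N"
proof -
  interpret L: reynolds_lieder_pair s mu R d by fact
  note mu = L.bracket_alternating_bilinear
  have bt: "\<And>i. alternating_bilinear s (mut i)" "mut 0 = mu"
    and Rt: "\<And>i. module_hom s s (Rt i)" "Rt 0 = R"
    and dt: "\<And>i. module_hom s s (dt i)" "dt 0 = d"
    and D: "reynolds_lieder_pair (fps_scale s) (ext2 mut) (ext1 Rt) (ext1 dt)"
    using deform by (auto simp: formal_deformation_def)
  interpret D: reynolds_lieder_pair "fps_scale s" "ext2 mut" "ext1 Rt" "ext1 dt" by fact
  define E where "E = bracket_defect mut mu psi N"
  define F where "F = map_defect Rt R psi N"
  define G where "G = map_defect dt d psi N"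
  have jB: "jet psi N (ext2 mut X Y) (mu x y) (E x y + mu u y + mu x v)"
    if "jet psi N X x u" "jet psi N Y y v" for X Y x y u v
    unfolding E_def by (rule jet_ext2[where s = s])
      (use bt psi(2) N below that in \<open>auto simp: trivialises_at_def\<close>)
  have jR: "jet psi N (ext1 Rt X) (R x) (F x + R u)" if "jet psi N X x u" for X x u
    unfolding F_def by (rule jet_ext1[where s = s])
      (use Rt below that in \<open>auto simp: trivialises_at_def\<close>)
  have jd: "jet psi N (ext1 dt X) (d x) (G x + d u)" if "jet psi N X x u" for X x u
    unfolding G_def by (rule jet_ext1[where s = s])
      (use dt below that in \<open>auto simp: trivialises_at_def\<close>)
  note jadd = jet_add[OF psi(1)] and jdiff = jet_diff[OF psi(1)]
  note P = jet_orbit[of psi N]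
  note zero = module_homD(2)[OF L.R_linear] module_homD(2)[OF L.d_linear]
    module_homD(2)[OF alternating_bilinearD(1)[OF mu]]
    module_homD(2)[OF alternating_bilinearD(2)[OF mu]]
  have E: "alternating_bilinear s E"
    unfolding E_def using alternating_bilinearD(3)[OF D.bracket_alternating_bilinear]
    by (intro bracket_defect_alternating_bilinear mu bt psi)
  have F: "module_hom s s F"
    unfolding F_def by (intro map_defect_linear L.R_linear Rt psi)
  have G: "module_hom s s G"
    unfolding G_def by (intro map_defect_linear L.d_linear dt psi)
  \<comment> \<open>Each identity of the deformed structure is evaluated on the images of constants, which are the
    jets \<open>(x, 0)\<close>.\<close>
  have jac: "E x (mu y z) + mu x (E y z) + (E y (mu z x) + mu y (E z x))
        + (E z (mu x y) + mu z (E x y)) = 0" for x y z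
  proof -
    have "jet psi N 0 0 (E x (mu y z) + mu x (E y z) + (E y (mu z x) + mu y (E z x))
        + (E z (mu x y) + mu z (E x y)))"
      using jadd[OF jadd[OF jB[OF P jB[OF P P]] jB[OF P jB[OF P P]]] jB[OF P jB[OF P P]], of x y z y z x z x y]
      by (simp add: zero D.jacobi L.jacobi)
    moreover have "jet psi N 0 0 0"
      by (simp add: jet_def module_homD(2)[OF psi(1)])
    ultimately show ?thesis by (rule jet_unique)
  qed
  have rey: "E (R x) (R y) + mu (F x) (R y) + mu (R x) (F y) =
        F (mu (R x) y + mu x (R y) - mu (R x) (R y))
        + R (E (R x) y + mu (F x) y + (E x (R y) + mu x (F y))
             - (E (R x) (R y) + mu (F x) (R y) + mu (R x) (F y)))" for x y
  proof (rule jet_unique)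
    show "jet psi N (ext2 mut (ext1 Rt (orbit psi x)) (ext1 Rt (orbit psi y))) (mu (R x) (R y))
      (E (R x) (R y) + mu (F x) (R y) + mu (R x) (F y))"
      using jB[OF jR[OF P] jR[OF P], of x y] by (simp add: zero)
    show "jet psi N (ext2 mut (ext1 Rt (orbit psi x)) (ext1 Rt (orbit psi y))) (mu (R x) (R y))
      (F (mu (R x) y + mu x (R y) - mu (R x) (R y))
        + R (E (R x) y + mu (F x) y + (E x (R y) + mu x (F y))
             - (E (R x) (R y) + mu (F x) (R y) + mu (R x) (F y))))"
      using jR[OF jdiff[OF jadd[OF jB[OF jR[OF P] P] jB[OF P jR[OF P]]] jB[OF jR[OF P] jR[OF P]]],
          of x y x y x y]
      by (simp add: zero flip: D.reynolds L.reynolds)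
  qed
  have der: "G (mu x y) + d (E x y) = E (d x) y + mu (G x) y + (E x (d y) + mu x (G y))" for x y
  proof (rule jet_unique)
    show "jet psi N (ext1 dt (ext2 mut (orbit psi x) (orbit psi y))) (d (mu x y))
       (G (mu x y) + d (E x y))"
      using jd[OF jB[OF P P], of x y] by (simp add: zero)
    show "jet psi N (ext1 dt (ext2 mut (orbit psi x) (orbit psi y))) (d (mu x y))
       (E (d x) y + mu (G x) y + (E x (d y) + mu x (G y)))"
      using jadd[OF jB[OF jd[OF P] P] jB[OF P jd[OF P]], of x y x y]
      by (simp add: zero D.derivation L.derivation)
  qed
  have com: "F (d x) + R (G x) = G (R x) + d (F x)" for x
  proof (rule jet_unique)
    show "jet psi N (ext1 Rt (ext1 dt (orbit psi x))) (R (d x)) (F (d x) + R (G x))"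
      using jR[OF jd[OF P], of x] by (simp add: zero)
    show "jet psi N (ext1 Rt (ext1 dt (orbit psi x))) (R (d x)) (G (R x) + d (F x))"
      using jd[OF jR[OF P], of x] fun_cong[OF D.R_d_commute, of "orbit psi x"] fun_cong[OF L.R_d_commute, of x]
      by (simp add: zero)
  qed
  obtain f where f: "module_hom s s f"
    "\<And>x y. E x y = mu x (f y) + mu (f x) y - f (mu x y)"
    "\<And>x. F x = R (f x) - f (R x)" "\<And>x. G x = d (f x) - f (d x)"
    by (rule infinitesimal_is_coboundary[OF pair H E F G jac rey der com]) blast
  define g where "g = (\<lambda>x. - f x)"
  \<comment> \<open>At order \<open>N\<close> the deformed bracket of \<open>(x, g x)\<close> and \<open>(y, g y)\<close> has the extra term
    \<open>E x y + [g x, y] + [x, g y]\<close>, to be compared with \<open>g [x, y]\<close> from the corrected image of \<open>[x, y]\<close>;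
    the operators are treated alike.\<close>
  define psi' where "psi' = psi(N := \<lambda>x. psi N x + g x)"
  have Q: "jet psi N (orbit psi' x) x (g x)" for x
    unfolding psi'_def by (rule jet_update)
  have psi'_N: "psi' N = (\<lambda>x. psi N x + g x)" by (simp add: psi'_def)
  have top: "fps_nth X N = psi N a + u" if "jet psi N X a u" for X a u
    using that by (simp add: jet_def)
  note neg = module_homD(3)[OF L.R_linear] module_homD(3)[OF L.d_linear]
    module_homD(3)[OF alternating_bilinearD(1)[OF mu]]
    module_homD(3)[OF alternating_bilinearD(2)[OF mu]]
  show thesis
  proof
    show "module_hom s s g"
      using f(1) unfolding g_def
      by (intro module_homI[OF L.module_axioms])
        (simp_all add: module_homD(1,5)[OF f(1)] L.scale_minus_right)
    have "bracket_defect mut mu psi' N x y = 0" for x y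
      using top[OF jB[OF Q Q], of x y] f(2)[of x y]
      by (simp add: bracket_defect_def psi'_N g_def neg)
    moreover have "map_defect Rt R psi' N x = 0" for x
      using top[OF jR[OF Q], of x] f(3)[of x] by (simp add: map_defect_def psi'_N g_def neg)
    moreover have "map_defect dt d psi' N x = 0" for x
      using top[OF jd[OF Q], of x] f(4)[of x] by (simp add: map_defect_def psi'_N g_def neg)
    ultimately show "trivialises_at mu R d mut Rt dt (psi(N := \<lambda>x. psi N x + g x)) N"
      unfolding psi'_def[symmetric] by (simp add: trivialises_at_def fun_eq_iff)
  qed
qed

text \<open>Dependent choice yields a sequence of series, each agreeing with its predecessor up to the order
  already treated. Its diagonal agrees with the \<open>n\<close>-th member up to degree \<open>n\<close> and thus inherits all
  its relations, because the defect at order \<open>n\<close> only involves these coefficients.\<close>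

lemma formal_trivialisation_exists:
  fixes s :: "'k::field \<Rightarrow> 'v::ab_group_add \<Rightarrow> 'v"
  assumes pair: "reynolds_lieder_pair s mu R d"
    and H: "H_RLieDer s mu R d 2 = {coboundaries_RLieDer s mu R d 2}"
    and deform: "formal_deformation s mu R d mut Rt dt"
  obtains psi where "\<And>i. module_hom s s (psi i)" "psi 0 = id"
    "\<And>n. trivialises_at mu R d mut Rt dt psi n"
proof -
  let ?T = "trivialises_at mu R d mut Rt dt"
  let ?P = "\<lambda>n psi. (\<forall>i. module_hom s s (psi i)) \<and> psi 0 = id \<and> (\<forall>i\<le>n. ?T psi i)"
  let ?Q = "\<lambda>n psi psi'. \<forall>i\<le>n. psi' i = psi i"
  interpret reynolds_lieder_pair s mu R d by fact
  have "\<exists>\<Psi>. \<forall>n. ?P n (\<Psi> n) \<and> ?Q n (\<Psi> n) (\<Psi> (Suc n))"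
  proof (rule dependent_nat_choice)
    have "module_hom s s (constant_series id i)" for i
      by (simp add: constant_series_def module_hom_iff module_axioms)
    moreover have "?T (constant_series id) 0"
      using deform by (simp add: trivialises_at_def bracket_defect_def map_defect_def
          nth_ext1 nth_ext2 constant_series_def formal_deformation_def fun_eq_iff)
    ultimately show "\<exists>psi. ?P 0 psi"
      by (intro exI[of _ "constant_series id"]) (auto simp: constant_series_def)
  next
    fix psi n assume P: "?P n psi"
    obtain g where g: "module_hom s s g" "?T (psi(Suc n := \<lambda>x. psi (Suc n) x + g x)) (Suc n)"
      by (rule extend_trivialisation[OF pair H deform, of psi "Suc n"]) (use P in auto)
    define psi' where "psi' = psi(Suc n := \<lambda>x. psi (Suc n) x + g x)"
    have "module_hom s s (psi' i)" for i
      using P g(1) module_homD(1,5)[of s "psi (Suc n)"] module_homD(1,5)[OF g(1)]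
      by (auto simp: psi'_def scale_right_distrib intro!: module_homI[OF module_axioms])
    moreover have Q: "?Q n psi psi'" by (simp add: psi'_def)
    moreover have "?T psi' i" if "i \<le> Suc n" for i
    proof (cases "i = Suc n")
      case False
      with that have "?T psi' i = ?T psi i"
        using Q by (intro trivialises_at_cong) auto
      with False that P show ?thesis by auto
    qed (use g(2) in \<open>simp add: psi'_def\<close>)
    ultimately show "\<exists>psi'. ?P (Suc n) psi' \<and> ?Q n psi psi'"
      using P by (intro exI[of _ psi']) (auto simp: psi'_def)
  qed
  then obtain \<Psi> where \<Psi>: "\<And>n. ?P n (\<Psi> n)" "\<And>n. ?Q n (\<Psi> n) (\<Psi> (Suc n))" by blast
  have stable: "\<Psi> n i = \<Psi> i i" if "i \<le> n" for n i
    using that \<Psi>(2) by (induction n rule: dec_induct) auto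
  show thesis
  proof
    show "module_hom s s (\<Psi> i i)" for i using \<Psi>(1) by blast
    show "\<Psi> 0 0 = id" using \<Psi>(1) by blast
    have "?T (\<lambda>i. \<Psi> i i) n = ?T (\<Psi> n) n" for n
      by (rule trivialises_at_cong) (rule stable[symmetric])
    then show "?T (\<lambda>i. \<Psi> i i) n" for n
      using \<Psi>(1)[of n] by blast
  qed
qed

theorem theorem4p3:
  fixes s :: "'k::field \<Rightarrow> 'v::ab_group_add \<Rightarrow> 'v"
    and mu :: "'v \<Rightarrow> 'v \<Rightarrow> 'v" and R d :: "'v \<Rightarrow> 'v"
  assumes "vector_space s"
    and "reynolds_lieder_pair s mu R d"
    and "H_RLieDer s mu R d 2 = {coboundaries_RLieDer s mu R d 2}"
  shows "rigid s mu R d"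
  unfolding rigid_def
proof (intro allI impI)
  fix mut Rt dt assume deform: "formal_deformation s mu R d mut Rt dt"
  interpret reynolds_lieder_pair s mu R d by fact
  obtain psi where psi: "\<And>i. module_hom s s (psi i)" "psi 0 = id"
    "\<And>n. trivialises_at mu R d mut Rt dt psi n"
    by (rule formal_trivialisation_exists[OF assms(2,3) deform]) blast
  have bt: "\<And>i. alternating_bilinear s (mut i)" and Rt: "\<And>i. module_hom s s (Rt i)"
    and dt: "\<And>i. module_hom s s (dt i)"
    using deform by (auto simp: formal_deformation_def)
  have on_constants: "orbit psi (mu x y) = ext2 mut (orbit psi x) (orbit psi y)"
    "orbit psi (R x) = ext1 Rt (orbit psi x)" "orbit psi (d x) = ext1 dt (orbit psi x)" for x y
    using psi(3) unfolding trivialises_at_def bracket_defect_def map_defect_def fun_eq_iff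
    by (auto intro!: fps_ext)
  have "formal_isomorphism s psi mut Rt dt
      (constant_series mu) (constant_series R) (constant_series d)"
    unfolding formal_isomorphism_def
    by (intro conjI allI psi(1,2) ext2_intertwines_if_on_constants[where s = s]
        ext1_intertwines_if_on_constants[where s = s] bracket_alternating_bilinear
        R_linear d_linear bt Rt dt on_constants)
  then show "trivial_deformation s mu R d mut Rt dt"
    unfolding trivial_deformation_def equivalent_deformations_def by blast
qed

end
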